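(* Let $X$ be a non-empty set and $\mathcal{H}$ a non-empty set of functions $X\to\{0,1\}$. For all $N\in\mathbb{N}$, $\mathcal{PM}^*_{\mathcal{H}}(N)=\mathcal{M}^*_{\mathcal{H}^{\mathrm{am}}}(N)$; that is, the minimax apple tasting mistake bound of $\mathcal{H}$ equals the minimax ambiguous online learning mistake bound of $\mathcal{H}^{\mathrm{am}}$.
   Context: Conventions: $0\in\mathbb{N}$; $\Sigma^*$ is the set of finite words over $\Sigma$; for a word $w$, $w_k$ is its $k$-th symbol (starting from $0$) and $w_{:k}$ its prefix of length $k$. For $xy\in(X\times Y)^n$, $x\in X^n$ and $y\in Y^n$ denote its projections. Here $Y=\{0,1\}$. Translation. For $h:X\to\{0,1\}$ define $h^{\mathrm{am}}:X\to 2^{\{0,1\}}$ by $h^{\mathrm{am}}(x):=\{h(x)\}\cup\{1\}$, and $\mathcal{H}^{\mathrm{am}}:=\{h^{\mathrm{am}}\mid h\in\mathcal{H}\}$. Ambiguous online learning. An ambiguous learner is a map $A:(X\times Y)^*\times X\to 2^Y$. For $g:X\to 2^Y$ and $xy\in(X\times Y)^n$, $\mathcal{M}^A_g(xy):=\{k<n\mid y_k\notin A(xy_{:k},x_k)\text{ or }A(xy_{:k},x_k)\not\subseteq g(x_k)\}$. $\mathcal{C}_g(n)$ is the set of $xy\in(X\times Y)^n$ with $y_k\in g(x_k)$ for all $k<n$. For a class $\mathcal{G}$ of functions $X\to 2^Y$: $\mathcal{M}^A_g(N):=\max_{xy\in\mathcal{C}_g(N)}|\mathcal{M}^A_g(xy)|$,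 $\mathcal{M}^A_{\mathcal{G}}(N):=\max_{g\in\mathcal{G}}\mathcal{M}^A_g(N)$, $\mathcal{M}^*_{\mathcal{G}}(N):=\min_A\mathcal{M}^A_{\mathcal{G}}(N)$. Apple tasting. An apple tasting learner is a map $A:(X\times\{0,1\})^*\times X\to\{0,1\}$. For $h:X\to\{0,1\}$, $\mathcal{C}^A_h(n)$ is the set of $xy\in(X\times\{0,1\})^n$ such that for all $k<n$: if $A(xy_{:k},x_k)=0$ then $y_k=1$, and if $A(xy_{:k},x_k)=1$ then $y_k=h(x_k)$ ($y$ represents feedback; "no feedback" is represented by $1$). For $xy\in\mathcal{C}^A_h(n)$, $\mathcal{PM}^A_h(xy):=\{k<n\mid A(xy_{:k},x_k)\neq h(x_k)\}$. Then $\mathcal{PM}^A_h(N):=\max_{xy\in\mathcal{C}^A_h(N)}|\mathcal{PM}^A_h(xy)|$, $\mathcal{PM}^A_{\mathcal{H}}(N):=\max_{h\in\mathcal{H}}\mathcal{PM}^A_h(N)$, $\mathcal{PM}^*_{\mathcal{H}}(N):=\min_A\mathcal{PM}^A_{\mathcal{H}}(N)$. *)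

theory Defs
  imports Main
begin

text \<open>
  The labels 0 and 1 are the Booleans \<open>False\<close> and \<open>True\<close>. The instance set is (the universe
  of) a type, hence non-empty. A word over pairs is a list of pairs; its two projections are
  taken position by position with \<open>fst\<close> and \<open>snd\<close>.
\<close>

definition ambig :: "('x \<Rightarrow> bool) \<Rightarrow> 'x \<Rightarrow> bool set" where
  "ambig h x = {h x} \<union> {True}"

definition ambig_class :: "('x \<Rightarrow> bool) set \<Rightarrow> ('x \<Rightarrow> bool set) set" where
  "ambig_class H = {ambig h | h. h \<in> H}"


type_synonym ('x, 'y) amb_learner = "('x \<times> 'y) list \<times> 'x \<Rightarrow> 'y set"

definition amb_mistakes ::
  "('x, 'y) amb_learner \<Rightarrow> ('x \<Rightarrow> 'y set) \<Rightarrow> ('x \<times> 'y) list \<Rightarrow> nat set" where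
  "amb_mistakes A g xy =
     {k. k < length xy \<and>
         (snd (xy ! k) \<notin> A (take k xy, fst (xy ! k)) \<or>
          \<not> A (take k xy, fst (xy ! k)) \<subseteq> g (fst (xy ! k)))}"

definition amb_consistent :: "('x \<Rightarrow> 'y set) \<Rightarrow> nat \<Rightarrow> ('x \<times> 'y) list set" where
  "amb_consistent g n = {xy. length xy = n \<and> (\<forall>k<n. snd (xy ! k) \<in> g (fst (xy ! k)))}"

text \<open>
  All sets of mistake counts below are subsets of \<open>{0..N}\<close>, hence finite, although they are
  images of possibly infinite sets; so \<open>Max\<close> and \<open>Min\<close> are genuine as soon as the sets are
  non-empty. In the ambiguous setting non-emptiness requires a non-empty class of hypotheses
  each admitting at least one consistent word.
\<close>

definition amb_bound_fun :: "('x, 'y) amb_learner \<Rightarrow> ('x \<Rightarrow> 'y set) \<Rightarrow> nat \<Rightarrow> nat" where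
  "amb_bound_fun A g N = Max ((\<lambda>xy. card (amb_mistakes A g xy)) ` amb_consistent g N)"

definition amb_bound :: "('x, 'y) amb_learner \<Rightarrow> ('x \<Rightarrow> 'y set) set \<Rightarrow> nat \<Rightarrow> nat" where
  "amb_bound A G N = Max ((\<lambda>g. amb_bound_fun A g N) ` G)"

definition amb_minimax :: "('x \<Rightarrow> 'y set) set \<Rightarrow> nat \<Rightarrow> nat" where
  "amb_minimax G N = Min (range (\<lambda>A. amb_bound A G N))"


type_synonym 'x apple_learner = "('x \<times> bool) list \<times> 'x \<Rightarrow> bool"

text \<open>
  The second component of a round is the feedback received. It is the true label if the
  learner predicted 1; after a prediction of 0 there is no feedback, recorded as 1.
\<close>

definition apple_consistent ::
  "'x apple_learner \<Rightarrow> ('x \<Rightarrow> bool) \<Rightarrow> nat \<Rightarrow> ('x \<times> bool) list set" where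
  "apple_consistent A h n =
     {xy. length xy = n \<and>
          (\<forall>k<n. (A (take k xy, fst (xy ! k)) = False \<longrightarrow> snd (xy ! k) = True) \<and>
                 (A (take k xy, fst (xy ! k)) = True \<longrightarrow> snd (xy ! k) = h (fst (xy ! k))))}"

definition apple_mistakes ::
  "'x apple_learner \<Rightarrow> ('x \<Rightarrow> bool) \<Rightarrow> ('x \<times> bool) list \<Rightarrow> nat set" where
  "apple_mistakes A h xy =
     {k. k < length xy \<and> A (take k xy, fst (xy ! k)) \<noteq> h (fst (xy ! k))}"

definition apple_bound_fun :: "'x apple_learner \<Rightarrow> ('x \<Rightarrow> bool) \<Rightarrow> nat \<Rightarrow> nat" where
  "apple_bound_fun A h N = Max ((\<lambda>xy. card (apple_mistakes A h xy)) ` apple_consistent A h N)"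

definition apple_bound :: "'x apple_learner \<Rightarrow> ('x \<Rightarrow> bool) set \<Rightarrow> nat \<Rightarrow> nat" where
  "apple_bound A H N = Max ((\<lambda>h. apple_bound_fun A h N) ` H)"

definition apple_minimax :: "('x \<Rightarrow> bool) set \<Rightarrow> nat \<Rightarrow> nat" where
  "apple_minimax H N = Min (range (\<lambda>A. apple_bound A H N))"


text \<open>The sets whose extrema occur in the theorem are finite and non-empty.\<close>

lemma amb_counts_finite: "finite ((\<lambda>xy. card (amb_mistakes A g xy)) ` amb_consistent g N)"
proof (rule finite_subset)
  have "card (amb_mistakes A g xy) \<le> length xy" for xy
    using card_mono[of "{..<length xy}" "amb_mistakes A g xy"]
    by (auto simp: amb_mistakes_def)
  then show "(\<lambda>xy. card (amb_mistakes A g xy)) ` amb_consistent g N \<subseteq> {..N}"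
    by (auto simp: amb_consistent_def)
qed simp

lemma apple_counts_finite:
  "finite ((\<lambda>xy. card (apple_mistakes A h xy)) ` apple_consistent A h N)"
proof (rule finite_subset)
  have "card (apple_mistakes A h xy) \<le> length xy" for xy
    using card_mono[of "{..<length xy}" "apple_mistakes A h xy"]
    by (auto simp: apple_mistakes_def)
  then show "(\<lambda>xy. card (apple_mistakes A h xy)) ` apple_consistent A h N \<subseteq> {..N}"
    by (auto simp: apple_consistent_def)
qed simp

lemma amb_consistent_ambig_nonempty: "amb_consistent (ambig h) N \<noteq> {}"
proof -
  have "replicate N (undefined, True) \<in> amb_consistent (ambig h) N"
    by (simp add: amb_consistent_def ambig_def)
  then show ?thesis by blast
qed

lemma apple_consistent_nonempty: "apple_consistent A h N \<noteq> {}"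
proof (induction N)
  case 0
  then show ?case by (simp add: apple_consistent_def)
next
  case (Suc N)
  then obtain w where w: "w \<in> apple_consistent A h N" by blast
  define y where "y = (A (w, undefined) \<longrightarrow> h undefined)"
  have "w @ [(undefined, y)] \<in> apple_consistent A h (Suc N)"
    using w by (auto simp: apple_consistent_def y_def nth_append less_Suc_eq)
  then show ?case by blast
qed

lemma amb_bound_fun_ambig_le: "amb_bound_fun A (ambig h) N \<le> N"
proof -
  have "amb_bound_fun A (ambig h) N
          \<in> (\<lambda>xy. card (amb_mistakes A (ambig h) xy)) ` amb_consistent (ambig h) N"
    unfolding amb_bound_fun_def
    by (intro Max_in amb_counts_finite) (simp add: amb_consistent_ambig_nonempty)
  moreover have "card (amb_mistakes A (ambig h) xy) \<le> length xy" for xy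
    using card_mono[of "{..<length xy}" "amb_mistakes A (ambig h) xy"]
    by (auto simp: amb_mistakes_def)
  ultimately show ?thesis by (auto simp: amb_consistent_def)
qed

lemma apple_bound_fun_le: "apple_bound_fun A h N \<le> N"
proof -
  have "apple_bound_fun A h N
          \<in> (\<lambda>xy. card (apple_mistakes A h xy)) ` apple_consistent A h N"
    unfolding apple_bound_fun_def
    by (intro Max_in apple_counts_finite) (simp add: apple_consistent_nonempty)
  moreover have "card (apple_mistakes A h xy) \<le> length xy" for xy
    using card_mono[of "{..<length xy}" "apple_mistakes A h xy"]
    by (auto simp: apple_mistakes_def)
  ultimately show ?thesis by (auto simp: apple_consistent_def)
qed

lemma amb_bound_values_finite: "finite ((\<lambda>g. amb_bound_fun A g N) ` ambig_class H)"
  by (rule finite_subset[of _ "{..N}"]) (auto simp: ambig_class_def amb_bound_fun_ambig_le)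

lemma apple_bound_values_finite: "finite ((\<lambda>h. apple_bound_fun A h N) ` H)"
  by (rule finite_subset[of _ "{..N}"]) (auto simp: apple_bound_fun_le)

lemma amb_bounds_finite:
  assumes "H \<noteq> {}"
  shows "finite (range (\<lambda>A. amb_bound A (ambig_class H) N))"
proof (rule finite_subset)
  have "amb_bound A (ambig_class H) N \<le> N" for A
    using assms unfolding amb_bound_def
    by (subst Max_le_iff[OF amb_bound_values_finite])
       (auto simp: ambig_class_def amb_bound_fun_ambig_le)
  then show "range (\<lambda>A. amb_bound A (ambig_class H) N) \<subseteq> {..N}" by auto
qed simp

lemma apple_bounds_finite:
  assumes "H \<noteq> {}"
  shows "finite (range (\<lambda>A. apple_bound A H N))"
proof (rule finite_subset)
  have "apple_bound A H N \<le> N" for A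
    using assms unfolding apple_bound_def
    by (subst Max_le_iff[OF apple_bound_values_finite]) (auto simp: apple_bound_fun_le)
  then show "range (\<lambda>A. apple_bound A H N) \<subseteq> {..N}" by auto
qed simp

end

theory Submission
  imports Defs
begin

text \<open>
  Predicting 0 in apple tasting corresponds to the ambiguous prediction \<open>{0, 1}\<close>, predicting 1
  to \<open>{1}\<close>. An ambiguous learner is thus run directly on apple tasting feedback. Conversely, an
  apple tasting learner \<open>A\<close> is run on a subword of the ambiguous history: if \<open>A\<close> predicts 0, it is
  given the feedback 1 whatever the label was; if \<open>A\<close> predicts 1 and the label is 0, the true value
  is revealed to be 0; if \<open>A\<close> predicts 1 and the label is 1, the true value is unknown, but the
  ambiguous learner made no mistake, so the round is withheld from \<open>A\<close>.
\<close>

text \<open>Nested maxima are traded for a condition on single words, so that the two simulations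
  can be compared word by word.\<close>

lemma apple_bound_le_iff:
  assumes "H \<noteq> {}"
  shows "apple_bound A H N \<le> b \<longleftrightarrow>
    (\<forall>h\<in>H. \<forall>w\<in>apple_consistent A h N. card (apple_mistakes A h w) \<le> b)"
  using assms
  by (simp add: apple_bound_def apple_bound_fun_def apple_consistent_nonempty
      Max_le_iff[OF apple_bound_values_finite, unfolded apple_bound_fun_def]
      Max_le_iff[OF apple_counts_finite])

lemma amb_bound_le_iff:
  assumes "H \<noteq> {}"
  shows "amb_bound A (ambig_class H) N \<le> b \<longleftrightarrow>
    (\<forall>h\<in>H. \<forall>w\<in>amb_consistent (ambig h) N. card (amb_mistakes A (ambig h) w) \<le> b)"
proof -
  have "amb_bound A (ambig_class H) N \<le> b \<longleftrightarrow> (\<forall>h\<in>H. amb_bound_fun A (ambig h) N \<le> b)"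
    unfolding amb_bound_def
    using assms by (subst Max_le_iff[OF amb_bound_values_finite]) (auto simp: ambig_class_def)
  then show ?thesis
    by (simp add: amb_bound_fun_def amb_consistent_ambig_nonempty Max_le_iff[OF amb_counts_finite])
qed

lemma apple_minimax_le:
  assumes "H \<noteq> {}"
  shows "apple_minimax H N \<le> apple_bound A H N"
  unfolding apple_minimax_def using apple_bounds_finite[OF assms] by (rule Min_le) simp

lemma amb_minimax_le:
  assumes "H \<noteq> {}"
  shows "amb_minimax (ambig_class H) N \<le> amb_bound A (ambig_class H) N"
  unfolding amb_minimax_def using amb_bounds_finite[OF assms] by (rule Min_le) simp

lemma apple_minimax_attained:
  assumes "H \<noteq> {}"
  obtains A where "apple_minimax H N = apple_bound A H N"
  using Min_in[OF apple_bounds_finite[OF assms, of N]] unfolding apple_minimax_def by blast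

lemma amb_minimax_attained:
  assumes "H \<noteq> {}"
  obtains A where "amb_minimax (ambig_class H) N = amb_bound A (ambig_class H) N"
  using Min_in[OF amb_bounds_finite[OF assms, of N]] unfolding amb_minimax_def by blast


text \<open>The empty prediction is also read as 1; this is harmless, since it is an ambiguous
  mistake in any case.\<close>

definition apple_of_amb :: "('x, bool) amb_learner \<Rightarrow> 'x apple_learner" where
  "apple_of_amb A p \<longleftrightarrow> False \<notin> A p"

lemma apple_consistent_apple_of_ambD:
  assumes "w \<in> apple_consistent (apple_of_amb A) h n"
  shows "w \<in> amb_consistent (ambig h) n"
  using assms by (auto simp: apple_consistent_def amb_consistent_def ambig_def)

text \<open>A wrong prediction of 1 draws the feedback 0, which \<open>A\<close> had excluded. A
  wrong prediction of 0 means that \<open>A\<close> admits 0 although \<open>ambig h\<close> yields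
  only \<open>{True}\<close> there, so the inclusion in \<open>ambig h\<close> fails.\<close>

lemma apple_mistakes_apple_of_amb:
  assumes "w \<in> apple_consistent (apple_of_amb A) h n"
  shows "apple_mistakes (apple_of_amb A) h w \<subseteq> amb_mistakes A (ambig h) w"
  using assms
  by (auto simp: apple_consistent_def apple_mistakes_def amb_mistakes_def ambig_def apple_of_amb_def)

lemma apple_minimax_le_amb_minimax:
  assumes "H \<noteq> {}"
  shows "apple_minimax H N \<le> amb_minimax (ambig_class H) N"
proof -
  obtain A where A: "amb_minimax (ambig_class H) N = amb_bound A (ambig_class H) N"
    using amb_minimax_attained[OF assms] .
  have "apple_bound (apple_of_amb A) H N \<le> amb_bound A (ambig_class H) N"
    unfolding apple_bound_le_iff[OF assms]
  proof (intro ballI)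
    fix h w
    assume h: "h \<in> H" and w: "w \<in> apple_consistent (apple_of_amb A) h N"
    have "card (apple_mistakes (apple_of_amb A) h w) \<le> card (amb_mistakes A (ambig h) w)"
      by (rule card_mono[OF _ apple_mistakes_apple_of_amb[OF w]]) (simp add: amb_mistakes_def)
    also have "\<dots> \<le> amb_bound A (ambig_class H) N"
      using amb_bound_le_iff[OF assms, of A N] h apple_consistent_apple_of_ambD[OF w] by blast
    finally show "card (apple_mistakes (apple_of_amb A) h w) \<le> amb_bound A (ambig_class H) N" .
  qed
  then show ?thesis
    using apple_minimax_le[OF assms, of N "apple_of_amb A"] A by simp
qed


text \<open>The implication is the one admissible feedback: 1 after a prediction of 0, the true
  label after a prediction of 1.\<close>

lemma apple_consistent_snoc_iff:
  "w @ [(x, y)] \<in> apple_consistent A h (Suc n) \<longleftrightarrow>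
    w \<in> apple_consistent A h n \<and> y = (A (w, x) \<longrightarrow> h x)"
  by (auto simp: apple_consistent_def nth_append less_Suc_eq)

lemma amb_consistent_snoc_iff:
  "w @ [(x, y)] \<in> amb_consistent g (Suc n) \<longleftrightarrow> w \<in> amb_consistent g n \<and> y \<in> g x"
  by (auto simp: amb_consistent_def nth_append less_Suc_eq)

text \<open>Each prediction sees only the preceding rounds, so a new round leaves earlier mistakes
  unchanged.\<close>

lemma apple_mistakes_snoc:
  "apple_mistakes A h (w @ [(x, y)]) =
    apple_mistakes A h w \<union> (if A (w, x) \<noteq> h x then {length w} else {})"
  by (auto simp: apple_mistakes_def nth_append less_Suc_eq)

lemma amb_mistakes_snoc:
  "amb_mistakes A g (w @ [(x, y)]) =
    amb_mistakes A g w \<union> (if y \<in> A (w, x) \<and> A (w, x) \<subseteq> g x then {} else {length w})"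
  by (auto simp: amb_mistakes_def nth_append less_Suc_eq)

lemma card_apple_mistakes_snoc:
  "card (apple_mistakes A h (w @ [(x, y)])) =
    card (apple_mistakes A h w) + (if A (w, x) \<noteq> h x then 1 else 0)"
proof -
  have "finite (apple_mistakes A h w)" "length w \<notin> apple_mistakes A h w"
    by (auto simp: apple_mistakes_def)
  then show ?thesis by (simp add: apple_mistakes_snoc)
qed

lemma card_amb_mistakes_snoc:
  "card (amb_mistakes A g (w @ [(x, y)])) =
    card (amb_mistakes A g w) + (if y \<in> A (w, x) \<and> A (w, x) \<subseteq> g x then 0 else 1)"
proof -
  have "finite (amb_mistakes A g w)" "length w \<notin> amb_mistakes A g w"
    by (auto simp: amb_mistakes_def)
  then show ?thesis by (simp add: amb_mistakes_snoc)
qed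

text \<open>Withheld rounds make the simulated history shorter than \<open>N\<close>, whereas the
  bound concerns words of length exactly \<open>N\<close>. Padding with an arbitrary instance and
  the forced feedback never lowers the count.\<close>

lemma apple_consistent_extend:
  assumes "v \<in> apple_consistent A h m" "m \<le> N"
  obtains w where "w \<in> apple_consistent A h N"
    "card (apple_mistakes A h v) \<le> card (apple_mistakes A h w)"
proof -
  from \<open>m \<le> N\<close> have "\<exists>w\<in>apple_consistent A h N.
      card (apple_mistakes A h v) \<le> card (apple_mistakes A h w)"
  proof (induction N rule: dec_induct)
    case base
    then show ?case using assms(1) by blast
  next
    case (step n)
    then obtain w where "w \<in> apple_consistent A h n"
      "card (apple_mistakes A h v) \<le> card (apple_mistakes A h w)" by blast
    then show ?case
      by (intro bexI[of _ "w @ [(undefined, A (w, undefined) \<longrightarrow> h undefined)]"])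
        (auto simp: apple_consistent_snoc_iff card_apple_mistakes_snoc)
  qed
  with that show ?thesis by blast
qed


definition apple_step ::
  "'x apple_learner \<Rightarrow> 'x \<times> bool \<Rightarrow> ('x \<times> bool) list \<Rightarrow> ('x \<times> bool) list" where
  "apple_step A p v =
    (if A (v, fst p) then if snd p then v else v @ [(fst p, False)] else v @ [(fst p, True)])"

definition apple_history ::
  "'x apple_learner \<Rightarrow> ('x \<times> bool) list \<Rightarrow> ('x \<times> bool) list" where
  "apple_history A w = fold (apple_step A) w []"

definition amb_of_apple :: "'x apple_learner \<Rightarrow> ('x, bool) amb_learner" where
  "amb_of_apple A p = (if A (apple_history A (fst p), snd p) then {True} else {False, True})"

lemma apple_history_snoc:
  "apple_history A (w @ [p]) = apple_step A p (apple_history A w)"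
  by (simp add: apple_history_def)

text \<open>Induction on the rounds: every retained round is a mistake for both learners or for
  neither, and a withheld round is no ambiguous mistake. Withholding is why \<open>m\<close> may be
  below the length of \<open>w\<close>.\<close>

lemma apple_history_simulates:
  assumes "w \<in> amb_consistent (ambig h) (length w)"
  shows "\<exists>m\<le>length w. apple_history A w \<in> apple_consistent A h m \<and>
    card (apple_mistakes A h (apple_history A w)) =
      card (amb_mistakes (amb_of_apple A) (ambig h) w)"
  using assms
proof (induction w rule: rev_induct)
  case Nil
  then show ?case
    by (simp add: apple_history_def apple_consistent_def apple_mistakes_def amb_mistakes_def)
next
  case (snoc p w)
  obtain x y where p: "p = (x, y)" by (cases p)
  define v where "v = apple_history A w"
  have w: "w \<in> amb_consistent (ambig h) (length w)" and y: "h x \<longrightarrow> y"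
    using snoc.prems by (auto simp: p amb_consistent_snoc_iff ambig_def[of h x])
  obtain m where m: "m \<le> length w" "v \<in> apple_consistent A h m"
    and card: "card (apple_mistakes A h v) = card (amb_mistakes (amb_of_apple A) (ambig h) w)"
    using snoc.IH[OF w] unfolding v_def by blast
  \<comment> \<open>The prediction \<open>{True}\<close> always lies within \<open>ambig h x\<close>
    and fails only on label 0; the prediction \<open>{False, True}\<close> contains every label and
    fails only if \<open>h x\<close> is 1.\<close>
  have card_w: "card (amb_mistakes (amb_of_apple A) (ambig h) (w @ [p])) =
      card (apple_mistakes A h v) + (if (if A (v, x) then y else \<not> h x) then 0 else 1)"
    using y by (simp add: p card card_amb_mistakes_snoc amb_of_apple_def ambig_def flip: v_def)
  show ?case
  proof (cases "A (v, x) \<and> y")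
    case True
    then have "apple_history A (w @ [p]) = v"
      by (simp add: p apple_history_snoc apple_step_def flip: v_def)
    then show ?thesis using m True card_w by (intro exI[of _ m]) simp
  next
    case False
    \<comment> \<open>In a retained round the feedback is the negated prediction: 1 after 0, and 0
      after 1. In the latter case \<open>y\<close> is 0, which forces \<open>h x\<close> to be 0, so
      the feedback is truthful and \<open>A\<close> errs.\<close>
    then have "apple_history A (w @ [p]) = v @ [(x, \<not> A (v, x))]"
      by (auto simp: p apple_history_snoc apple_step_def simp flip: v_def)
    then show ?thesis
      using m False y
      by (intro exI[of _ "Suc m"])
        (auto simp: card_w apple_consistent_snoc_iff card_apple_mistakes_snoc)
  qed
qed

lemma amb_minimax_le_apple_minimax:
  assumes "H \<noteq> {}"
  shows "amb_minimax (ambig_class H) N \<le> apple_minimax H N"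
proof -
  obtain A where A: "apple_minimax H N = apple_bound A H N"
    using apple_minimax_attained[OF assms] .
  have "amb_bound (amb_of_apple A) (ambig_class H) N \<le> apple_bound A H N"
    unfolding amb_bound_le_iff[OF assms]
  proof (intro ballI)
    fix h w
    assume h: "h \<in> H" and w: "w \<in> amb_consistent (ambig h) N"
    then have N: "length w = N" by (simp add: amb_consistent_def)
    obtain m where "m \<le> N" "apple_history A w \<in> apple_consistent A h m"
      and card: "card (apple_mistakes A h (apple_history A w)) =
        card (amb_mistakes (amb_of_apple A) (ambig h) w)"
      using apple_history_simulates[of w h A] w N by blast
    then obtain u where "u \<in> apple_consistent A h N"
      "card (apple_mistakes A h (apple_history A w)) \<le> card (apple_mistakes A h u)"
      using apple_consistent_extend by blast
    then show "card (amb_mistakes (amb_of_apple A) (ambig h) w) \<le> apple_bound A H N"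
      using apple_bound_le_iff[OF assms, of A N "apple_bound A H N"] h card by fastforce
  qed
  then show ?thesis
    using amb_minimax_le[OF assms, of N "amb_of_apple A"] A by simp
qed

theorem corollary7p3:
  fixes H :: "('x \<Rightarrow> bool) set" and N :: nat
  assumes "H \<noteq> {}"
  shows "apple_minimax H N = amb_minimax (ambig_class H) N"
  using apple_minimax_le_amb_minimax[OF assms] amb_minimax_le_apple_minimax[OF assms]
  by (rule antisym)

end
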